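(* Let $\mathbb{K}$ be a complete non-Archimedean valued field with absolute value $|\cdot|$ satisfying $$\left|\sum_{j=1}^{N}\lambda_j^2\right|=\max_{1\leq j\leq N}|\lambda_j|^2\quad\text{for all } N\in\mathbb{N} \text{ and all } \lambda_1,\dots,\lambda_N\in\mathbb{K}.$$ Let $d,m,n\in\mathbb{N}$ (positive integers), and let $\{\tau_j\}_{j=1}^n$ be any collection of vectors in $\mathbb{K}^d$ such that the linear operator $$S_\tau:\text{Sym}^m(\mathbb{K}^d)\ni x\mapsto\sum_{j=1}^n\langle x,\tau_j^{\otimes m}\rangle\,\tau_j^{\otimes m}\in\text{Sym}^m(\mathbb{K}^d)$$ is diagonalizable. Then $$\max_{1\leq j,k\leq n,\ j\neq k}\left\{\left|\sum_{l=1}^n\langle\tau_l,\tau_l\rangle^{2m}\right|,\ |\langle\tau_j,\tau_k\rangle|^{2m}\right\}\geq\frac{1}{\left|\binom{d+m-1}{m}\right|}\left|\sum_{j=1}^n\langle\tau_j,\tau_j\rangle^m\right|^2.$$ In particular, if $\langle\tau_j,\tau_j\rangle=1$ for all $1\leq j\leq n$, then $$\max_{1\leq j,k\leq n,\ j\neq k}\left\{|n|,\ |\langle\tau_j,\tau_k\rangle|^{2m}\right\}\geq\frac{|n|^2}{\left|\binom{d+m-1}{m}\right|}.$$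
   Context: $\mathbb{K}^d$ carries the bilinear inner product $\langle (a_j)_{j=1}^d,(b_j)_{j=1}^d\rangle:=\sum_{j=1}^d a_jb_j$ (no conjugation). $\text{Sym}^m(\mathbb{K}^d)$ is the $\mathbb{K}$-vector space of symmetric $m$-tensors, i.e. the subspace of $(\mathbb{K}^d)^{\otimes m}$ fixed by all permutations of the tensor factors. It carries the restriction of the standard bilinear form on $(\mathbb{K}^d)^{\otimes m}$ determined by $\langle x_1\otimes\cdots\otimes x_m,\,y_1\otimes\cdots\otimes y_m\rangle=\prod_{i=1}^m\langle x_i,y_i\rangle$; in particular $\langle x^{\otimes m},y^{\otimes m}\rangle=\langle x,y\rangle^m$. For a positive integer $N$ (such as $n$ or a binomial coefficient), $|N|$ denotes the absolute value in $\mathbb{K}$ of the image $N\cdot 1_{\mathbb{K}}$. "Diagonalizable" means that the space has a $\mathbb{K}$-basis consisting of eigenvectors of the operator. The notation $\max_{1\le j,k\le n,\ j\ne k}\{A,B_{jk}\}$ denotes the maximum of the finite set of real numbers consisting of $A$ together with all $B_{jk}$ for $1\leq j,k\leq n$, $j\neq k$ (just $A$ when $n=1$). *)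

theory Defs
  imports "HOL-Analysis.Analysis"
begin

text \<open>
  The field is the whole type \<open>'k\<close>; its absolute value is a parameter, since the norm of the
  library's normed fields is Archimedean. The trivial absolute value is not excluded.
\<close>

locale nonarch_valued_field =
  fixes v :: "'k::field \<Rightarrow> real"
  assumes abs_nonneg: "0 \<le> v x"
    and abs_eq_0_iff: "v x = 0 \<longleftrightarrow> x = 0"
    and abs_mult: "v (x * y) = v x * v y"
    and abs_add_le_max: "v (x + y) \<le> max (v x) (v y)"
begin

lemma abs_one: "v 1 = 1"
proof -
  have "v 1 * v 1 = v 1" using abs_mult[of 1 1] by simp
  moreover have "v 1 \<noteq> 0" by (simp add: abs_eq_0_iff)
  ultimately show ?thesis by simp
qed

lemma abs_uminus: "v (- x) = v x"
proof -
  have "v (- 1) * v (- 1) = 1" using abs_mult[of "- 1" "- 1"] by (simp add: abs_one)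
  then have "(v (- 1))\<^sup>2 = 1\<^sup>2" by (simp add: power2_eq_square)
  then have "v (- 1) = 1" using abs_nonneg[of "- 1"] by (auto simp: power2_eq_1_iff)
  then show ?thesis using abs_mult[of "- 1" x] by simp
qed

sublocale Metric_space UNIV "\<lambda>x y. v (x - y)"
proof
  fix x y z :: 'k
  show "0 \<le> v (x - y)" by (rule abs_nonneg)
  show "v (x - y) = v (y - x)" using abs_uminus[of "x - y"] by simp
  show "v (x - y) = 0 \<longleftrightarrow> x = y" by (simp add: abs_eq_0_iff)
  show "v (x - z) \<le> v (x - y) + v (y - z)"
    using abs_add_le_max[of "x - y" "y - z"] abs_nonneg[of "x - y"] abs_nonneg[of "y - z"]
    by simp
qed

end

locale complete_nonarch_valued_field = nonarch_valued_field +
  assumes complete: mcomplete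

definition bilin :: "'k::field ^ 'i \<Rightarrow> 'k ^ 'i \<Rightarrow> 'k" where
  "bilin x y = (\<Sum>i\<in>UNIV. x $ i * y $ i)"

text \<open>
  With \<open>d = CARD('d)\<close> and \<open>m = CARD('m)\<close>, the \<open>m\<close>-th tensor power of \<open>'k ^ 'd\<close> is the space
  \<open>'k ^ ('m \<Rightarrow> 'd)\<close> of coordinate arrays indexed by multi-indices. The lemmas
  \<open>bilin_pure_tensor\<close>, \<open>span_pure_tensor\<close> and \<open>permute_pure_tensor\<close> below show that \<open>bilin\<close>
  on it is the form determined by its values on pure tensors, and that \<open>permute_tensor\<close>
  permutes the tensor factors.
\<close>

definition pure_tensor :: "('m::finite \<Rightarrow> 'k::field ^ 'd::finite) \<Rightarrow> 'k ^ ('m \<Rightarrow> 'd)" where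
  "pure_tensor x = (\<chi> i. \<Prod>k\<in>UNIV. x k $ i k)"

definition tensor_power :: "'k::field ^ 'd::finite \<Rightarrow> 'k ^ ('m::finite \<Rightarrow> 'd)" where
  "tensor_power x = pure_tensor (\<lambda>_. x)"

definition permute_tensor ::
    "('m::finite \<Rightarrow> 'm) \<Rightarrow> 'k::field ^ ('m \<Rightarrow> 'd::finite) \<Rightarrow> 'k ^ ('m \<Rightarrow> 'd)" where
  "permute_tensor p t = (\<chi> i. t $ (i \<circ> p))"

definition Sym :: "('k::field ^ ('m::finite \<Rightarrow> 'd::finite)) set" where
  "Sym = {t. \<forall>p. bij p \<longrightarrow> permute_tensor p t = t}"

definition frame_operator ::
    "nat \<Rightarrow> (nat \<Rightarrow> 'k::field ^ 'd::finite) \<Rightarrow> 'k ^ ('m::finite \<Rightarrow> 'd) \<Rightarrow> 'k ^ ('m \<Rightarrow> 'd)" where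
  "frame_operator n \<tau> x = (\<Sum>j=1..n. bilin x (tensor_power (\<tau> j)) *s tensor_power (\<tau> j))"

definition eigenvector :: "('k::field ^ 'i \<Rightarrow> 'k ^ 'i) \<Rightarrow> 'k ^ 'i \<Rightarrow> bool" where
  "eigenvector f x \<longleftrightarrow> x \<noteq> 0 \<and> (\<exists>c. f x = c *s x)"

text \<open>Meant for a subspace \<open>V\<close> that is invariant under the linear map \<open>f\<close>.\<close>

definition diagonalizable_on :: "('k::field ^ 'i) set \<Rightarrow> ('k ^ 'i \<Rightarrow> 'k ^ 'i) \<Rightarrow> bool" where
  "diagonalizable_on V f \<longleftrightarrow>
     (\<exists>B. B \<subseteq> V \<and> vec.independent B \<and> vec.span B = V \<and> (\<forall>b\<in>B. eigenvector f b))"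

lemma bilin_pure_tensor: "bilin (pure_tensor x) (pure_tensor y) = (\<Prod>k\<in>UNIV. bilin (x k) (y k))"
  using prod_sum_PiE[of UNIV "\<lambda>_. UNIV" "\<lambda>k i. x k $ i * y k $ i"]
  by (simp add: bilin_def pure_tensor_def prod.distrib PiE_UNIV_domain)

lemma bilin_tensor_power:
  "bilin (tensor_power x :: 'k::field ^ ('m::finite \<Rightarrow> 'd::finite)) (tensor_power y)
     = bilin x y ^ CARD('m)"
  by (simp add: tensor_power_def bilin_pure_tensor)

lemma span_pure_tensor:
  "vec.span (range pure_tensor) = (UNIV :: ('k::field ^ ('m::finite \<Rightarrow> 'd::finite)) set)"
proof -
  have "axis i 1 = (pure_tensor (\<lambda>k. axis (i k) 1) :: 'k ^ ('m \<Rightarrow> 'd))" for i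
    by (auto simp: pure_tensor_def axis_def vec_eq_iff fun_eq_iff)
  then have "cart_basis \<subseteq> (range pure_tensor :: ('k ^ ('m \<Rightarrow> 'd)) set)"
    by (auto simp: cart_basis_def)
  then show ?thesis using vec.span_mono span_cart_basis by blast
qed

lemma permute_pure_tensor:
  assumes "bij p"
  shows "permute_tensor p (pure_tensor x) = pure_tensor (x \<circ> inv p)"
proof -
  have "(\<Prod>k\<in>UNIV. x k $ i (p k)) = (\<Prod>k\<in>UNIV. x (inv p k) $ i k)" for i
    using prod.reindex_bij_betw[OF assms, of "\<lambda>k. x (inv p k) $ i k"] assms
    by (simp add: bij_is_inj)
  then show ?thesis by (simp add: permute_tensor_def pure_tensor_def)
qed

lemma subspace_Sym: "vec.subspace Sym"
  by (auto simp: vec.subspace_def Sym_def permute_tensor_def vec_eq_iff)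

lemma tensor_power_in_Sym: "tensor_power x \<in> Sym"
  by (simp add: Sym_def tensor_power_def permute_pure_tensor comp_def)

lemma frame_operator_in_Sym: "frame_operator n \<tau> x \<in> Sym"
  unfolding frame_operator_def
  by (intro vec.subspace_sum vec.subspace_scale subspace_Sym tensor_power_in_Sym)

end

theory Submission
  imports Defs
begin

text \<open>
  Taking all \<open>\<lambda>\<^sub>j = 1\<close> in the hypothesis gives \<open>|N| = 1\<close> for every positive integer \<open>N\<close>, so the
  binomial coefficient, and with it the dimension of the symmetric tensors, plays no role in
  the bound. If the frame operator has an eigenbasis with eigenvalues \<open>\<lambda>\<^sub>b\<close>, then comparing the
  traces of the operator and of its square gives
  \<open>\<Sum>\<lambda>\<^sub>b = \<Sum>\<^sub>j \<langle>\<tau>\<^sub>j, \<tau>\<^sub>j\<rangle>\<^sup>m\<close> and \<open>\<Sum>\<lambda>\<^sub>b\<^sup>2 = \<Sum>\<^sub>j\<^sub>,\<^sub>k \<langle>\<tau>\<^sub>j, \<tau>\<^sub>k\<rangle>\<^sup>2\<^sup>m\<close>. Hence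
  \<open>|\<Sum>\<lambda>\<^sub>b|\<^sup>2 \<le> max |\<lambda>\<^sub>b|\<^sup>2 = |\<Sum>\<lambda>\<^sub>b\<^sup>2|\<close>, and the ultrametric inequality bounds the last sum by
  its diagonal part and its off-diagonal terms.
\<close>

lemma bilin_commute: "bilin x y = bilin y x"
  by (simp add: bilin_def mult.commute)

lemma bilin_sum_scale_left:
  "bilin (\<Sum>b\<in>B. c b *s g b) y = (\<Sum>b\<in>B. c b * bilin (g b) y)"
proof -
  have "bilin (\<Sum>b\<in>B. c b *s g b) y = (\<Sum>i\<in>UNIV. \<Sum>b\<in>B. c b * (g b $ i * y $ i))"
    by (simp add: bilin_def sum_distrib_right mult.assoc)
  also have "\<dots> = (\<Sum>b\<in>B. \<Sum>i\<in>UNIV. c b * (g b $ i * y $ i))"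
    by (rule sum.swap)
  finally show ?thesis by (simp add: bilin_def sum_distrib_left)
qed

lemma (in nonarch_valued_field) abs_zero: "v 0 = 0"
  by (simp add: abs_eq_0_iff)

lemma (in nonarch_valued_field) abs_power: "v (x ^ k) = v x ^ k"
  by (induction k) (simp_all add: abs_one abs_mult)

text \<open>Nonnegativity of \<open>M\<close> covers the case where \<open>A\<close> is empty or
  infinite and the sum is 0.\<close>

lemma (in nonarch_valued_field) abs_sum_le:
  assumes "0 \<le> M" and "\<And>a. a \<in> A \<Longrightarrow> v (f a) \<le> M"
  shows "v (\<Sum>a\<in>A. f a) \<le> M"
  using assms(2)
proof (induction A rule: infinite_finite_induct)
  case (insert a A)
  then have "max (v (f a)) (v (\<Sum>a\<in>A. f a)) \<le> M" by simp
  with insert.hyps abs_add_le_max show ?case by (metis order_trans sum.insert)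
qed (use assms(1) in \<open>simp_all add: abs_zero\<close>)

text \<open>By \<open>max\<close> no cancellation occurs in a sum of squares, so its absolute value
  dominates every \<open>(v (f a))\<^sup>2\<close>; the ultrametric inequality passes this bound on
  to the sum of the \<open>f a\<close>.\<close>

lemma (in nonarch_valued_field) abs_sum_power2_le:
  assumes max: "\<And>(N::nat) l. N \<ge> 1 \<Longrightarrow>
      v (\<Sum>j=1..N. (l j)\<^sup>2) = Max {(v (l j))\<^sup>2 | j. j \<in> {1..N}}"
    and "finite A"
  shows "(v (\<Sum>a\<in>A. f a))\<^sup>2 \<le> v (\<Sum>a\<in>A. (f a)\<^sup>2)"
proof -
  have bound: "v (f a) \<le> sqrt (v (\<Sum>a\<in>A. (f a)\<^sup>2))" if "a \<in> A" for a
  proof -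
    \<comment> \<open>\<open>max\<close> concerns sums over \<open>{1..N}\<close>, so
      \<open>A\<close> is enumerated; having the element \<open>a\<close> makes
      \<open>card A\<close> positive.\<close>
    obtain h where h: "bij_betw h {1..card A} A"
      using ex_bij_betw_nat_finite_1[OF \<open>finite A\<close>] by blast
    then obtain j where j: "j \<in> {1..card A}" "a = h j"
      using \<open>a \<in> A\<close> by (metis bij_betw_imp_surj_on imageE)
    have "(v (f a))\<^sup>2 \<le> Max {(v (f (h j)))\<^sup>2 | j. j \<in> {1..card A}}"
      using j by (intro Max_ge) auto
    also have "\<dots> = v (\<Sum>j=1..card A. (f (h j))\<^sup>2)"
      using max[of "card A" "\<lambda>j. f (h j)"] j by simp
    also have "\<dots> = v (\<Sum>a\<in>A. (f a)\<^sup>2)"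
      using sum.reindex_bij_betw[OF h, of "\<lambda>a. (f a)\<^sup>2"] by simp
    finally show ?thesis by (rule real_le_rsqrt)
  qed
  have "v (\<Sum>a\<in>A. f a) \<le> sqrt (v (\<Sum>a\<in>A. (f a)\<^sup>2))"
    by (rule abs_sum_le) (use bound abs_nonneg in auto)
  then have "(v (\<Sum>a\<in>A. f a))\<^sup>2 \<le> (sqrt (v (\<Sum>a\<in>A. (f a)\<^sup>2)))\<^sup>2"
    by (rule power_mono) (rule abs_nonneg)
  then show ?thesis using abs_nonneg by simp
qed

lemma (in nonarch_valued_field) abs_of_nat_eq_1:
  assumes max: "\<And>(N::nat) l. N \<ge> 1 \<Longrightarrow>
      v (\<Sum>j=1..N. (l j)\<^sup>2) = Max {(v (l j))\<^sup>2 | j. j \<in> {1..N}}"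
    and "N \<ge> 1"
  shows "v (of_nat N) = 1"
proof -
  have "{(v 1)\<^sup>2 | j. j \<in> {1..N}} = {1}"
    using \<open>N \<ge> 1\<close> by (auto simp: abs_one)
  then show ?thesis using max[OF \<open>N \<ge> 1\<close>, of "\<lambda>_. 1"] by simp
qed

text \<open>The traces are computed by hand: expanding each \<open>t j\<close> in the eigenbasis
  gives the matrix of the operator, which is diagonal with entries \<open>e b\<close>, and
  interchanging sums recovers the pairings of the \<open>t j\<close>.\<close>

lemma eigenvalue_sums:
  fixes t :: "'j \<Rightarrow> 'k::field ^ 'i::finite"
  assumes diag: "diagonalizable_on V (\<lambda>x. \<Sum>j\<in>J. bilin x (t j) *s t j)"
    and t: "\<And>j. j \<in> J \<Longrightarrow> t j \<in> V"
  obtains B :: "('k ^ 'i) set" and e where "finite B"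
    and "(\<Sum>b\<in>B. e b) = (\<Sum>j\<in>J. bilin (t j) (t j))"
    and "(\<Sum>b\<in>B. (e b)\<^sup>2) = (\<Sum>j\<in>J. \<Sum>k\<in>J. (bilin (t j) (t k))\<^sup>2)"
proof -
  let ?S = "\<lambda>x. \<Sum>j\<in>J. bilin x (t j) *s t j"
  obtain B where B: "vec.independent B" "vec.span B = V" "\<forall>b\<in>B. eigenvector ?S b"
    using diag unfolding diagonalizable_on_def by blast
  have fin: "finite B" using B(1) by (rule vec.finiteI_independent)
  obtain e where e: "\<And>b. b \<in> B \<Longrightarrow> ?S b = e b *s b"
    using B(3) unfolding eigenvector_def by metis
  have "\<exists>u. t j = (\<Sum>b\<in>B. u b *s b)" if "j \<in> J" for j
    using t[OF that] B(2) vec.span_finite[OF fin] by auto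
  then obtain c where c: "\<And>j. j \<in> J \<Longrightarrow> t j = (\<Sum>b\<in>B. c j b *s b)"
    by metis
  \<comment> \<open>The left side is the coefficient of \<open>b'\<close> in the expansion of
    \<open>?S b\<close>.\<close>
  have matrix: "(\<Sum>j\<in>J. bilin b (t j) * c j b') = (if b' = b then e b else 0)"
    if b: "b \<in> B" and b': "b' \<in> B" for b b'
  proof -
    \<comment> \<open>Difference of the coefficients in two expansions of \<open>?S b\<close>;
      independence of \<open>B\<close> makes it vanish.\<close>
    let ?u = "\<lambda>b'. (\<Sum>j\<in>J. bilin b (t j) * c j b') - (if b' = b then e b else 0)"
    have "?S b = (\<Sum>j\<in>J. \<Sum>b'\<in>B. (bilin b (t j) * c j b') *s b')"
    proof (rule sum.cong)
      fix j assume "j \<in> J"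
      have "bilin b (t j) *s t j = bilin b (t j) *s (\<Sum>b'\<in>B. c j b' *s b')"
        using c[OF \<open>j \<in> J\<close>] by simp
      then show "bilin b (t j) *s t j = (\<Sum>b'\<in>B. (bilin b (t j) * c j b') *s b')"
        by (simp add: vec.scale_sum_right)
    qed simp
    also have "\<dots> = (\<Sum>b'\<in>B. (\<Sum>j\<in>J. bilin b (t j) * c j b') *s b')"
      by (subst sum.swap) (simp add: vec.scale_sum_left)
    finally have "(\<Sum>b'\<in>B. (\<Sum>j\<in>J. bilin b (t j) * c j b') *s b') = e b *s b"
      using e[OF b] by simp
    moreover have "(\<Sum>b'\<in>B. (if b' = b then e b else 0) *s b') = e b *s b"
      using b fin by (simp add: if_distrib[of "\<lambda>x. x *s _"] cong: if_cong)
    ultimately have "(\<Sum>b'\<in>B. ?u b' *s b') = 0"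
      by (simp add: vec.scale_left_diff_distrib sum_subtractf)
    from vec.independentD[OF B(1) fin _ this b'] show ?thesis by simp
  qed
  have pairing: "bilin (t j) y = (\<Sum>b\<in>B. c j b * bilin b y)" if "j \<in> J" for j y
    using bilin_sum_scale_left[of "c j" "\<lambda>b. b" B y] c[OF that] by simp
  have "(\<Sum>j\<in>J. bilin (t j) (t j)) = (\<Sum>j\<in>J. \<Sum>b\<in>B. bilin b (t j) * c j b)"
    by (rule sum.cong) (simp_all add: pairing[of _ "t _"] mult.commute)
  also have "\<dots> = (\<Sum>b\<in>B. \<Sum>j\<in>J. bilin b (t j) * c j b)"
    by (rule sum.swap)
  also have "\<dots> = (\<Sum>b\<in>B. e b)"
    by (simp add: matrix)
  finally have trace: "(\<Sum>b\<in>B. e b) = (\<Sum>j\<in>J. bilin (t j) (t j))" ..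
  have swap: "(\<Sum>j\<in>J. \<Sum>b\<in>B. \<Sum>b'\<in>B. F j b b') = (\<Sum>b\<in>B. \<Sum>b'\<in>B. \<Sum>j\<in>J. F j b b')"
    for F :: "'j \<Rightarrow> 'k ^ 'i \<Rightarrow> 'k ^ 'i \<Rightarrow> 'k"
    by (subst sum.swap) (intro sum.cong refl sum.swap)
  have "(\<Sum>j\<in>J. \<Sum>k\<in>J. (bilin (t j) (t k))\<^sup>2)
      = (\<Sum>j\<in>J. \<Sum>k\<in>J. \<Sum>b\<in>B. \<Sum>b'\<in>B. (bilin b (t k) * c k b') * (bilin b' (t j) * c j b))"
  proof (intro sum.cong refl)
    fix j k assume "j \<in> J" "k \<in> J"
    \<comment> \<open>By symmetry of the form, one factor is expanded through \<open>t j\<close> and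
      the other through \<open>t k\<close>. After regrouping, the sum over \<open>k\<close> is the
      matrix entry at \<open>b\<close>, \<open>b'\<close> and the sum over \<open>j\<close> the
      entry at \<open>b'\<close>, \<open>b\<close>.\<close>
    have "(bilin (t j) (t k))\<^sup>2 = bilin (t j) (t k) * bilin (t k) (t j)"
      by (simp add: power2_eq_square bilin_commute)
    also have "\<dots> = (\<Sum>b\<in>B. c j b * bilin b (t k)) * (\<Sum>b'\<in>B. c k b' * bilin b' (t j))"
      using pairing[OF \<open>j \<in> J\<close>, of "t k"] pairing[OF \<open>k \<in> J\<close>, of "t j"] by (simp only:)
    also have "\<dots> = (\<Sum>b\<in>B. \<Sum>b'\<in>B. (bilin b (t k) * c k b') * (bilin b' (t j) * c j b))"
      by (simp add: sum_product mult_ac)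
    finally show "(bilin (t j) (t k))\<^sup>2
        = (\<Sum>b\<in>B. \<Sum>b'\<in>B. (bilin b (t k) * c k b') * (bilin b' (t j) * c j b))" .
  qed
  also have "\<dots> = (\<Sum>j\<in>J. \<Sum>b\<in>B. \<Sum>b'\<in>B.
      (\<Sum>k\<in>J. bilin b (t k) * c k b') * (bilin b' (t j) * c j b))"
    by (simp only: swap sum_distrib_right)
  also have "\<dots> = (\<Sum>b\<in>B. \<Sum>b'\<in>B.
      (\<Sum>k\<in>J. bilin b (t k) * c k b') * (\<Sum>j\<in>J. bilin b' (t j) * c j b))"
    by (simp only: swap sum_distrib_left)
  also have "\<dots> = (\<Sum>b\<in>B. \<Sum>b'\<in>B. if b' = b then (e b)\<^sup>2 else 0)"
    by (intro sum.cong refl) (simp add: matrix power2_eq_square)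
  also have "\<dots> = (\<Sum>b\<in>B. (e b)\<^sup>2)"
    using fin by simp
  finally have "(\<Sum>b\<in>B. (e b)\<^sup>2) = (\<Sum>j\<in>J. \<Sum>k\<in>J. (bilin (t j) (t k))\<^sup>2)" ..
  with fin trace show thesis by (rule that)
qed

theorem theorem2p3:
  fixes v :: "'k::field \<Rightarrow> real"
    and n :: nat
    and \<tau> :: "nat \<Rightarrow> 'k ^ 'd::finite"
  assumes "complete_nonarch_valued_field v"
    and "\<And>(N::nat) (l :: nat \<Rightarrow> 'k). N \<ge> 1 \<Longrightarrow>
           v (\<Sum>j=1..N. (l j)\<^sup>2) = Max {(v (l j))\<^sup>2 | j. j \<in> {1..N}}"
    and "n \<ge> 1"
    and "diagonalizable_on (Sym :: ('k ^ ('m::finite \<Rightarrow> 'd)) set) (frame_operator n \<tau>)"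
  shows "Max (insert (v (\<Sum>l=1..n. bilin (\<tau> l) (\<tau> l) ^ (2 * CARD('m))))
               {v (bilin (\<tau> j) (\<tau> k)) ^ (2 * CARD('m)) | j k.
                  j \<in> {1..n} \<and> k \<in> {1..n} \<and> j \<noteq> k})
           \<ge> 1 / v (of_nat ((CARD('d) + CARD('m) - 1) choose CARD('m)))
               * (v (\<Sum>j=1..n. bilin (\<tau> j) (\<tau> j) ^ CARD('m)))\<^sup>2
         \<and> ((\<forall>j\<in>{1..n}. bilin (\<tau> j) (\<tau> j) = 1) \<longrightarrow>
             Max (insert (v (of_nat n))
               {v (bilin (\<tau> j) (\<tau> k)) ^ (2 * CARD('m)) | j k.
                  j \<in> {1..n} \<and> k \<in> {1..n} \<and> j \<noteq> k})
           \<ge> (v (of_nat n))\<^sup>2 / v (of_nat ((CARD('d) + CARD('m) - 1) choose CARD('m))))"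
proof -
  interpret complete_nonarch_valued_field v by fact
  note max = assms(2)
  let ?m = "CARD('m)" and ?J = "{1..n}"
  let ?C = "(CARD('d) + ?m - 1) choose ?m"
  let ?D = "\<Sum>l=1..n. bilin (\<tau> l) (\<tau> l) ^ (2 * ?m)"
  let ?O = "{v (bilin (\<tau> j) (\<tau> k)) ^ (2 * ?m) | j k. j \<in> ?J \<and> k \<in> ?J \<and> j \<noteq> k}"
  let ?M = "Max (insert (v ?D) ?O)"
  let ?T = "\<Sum>j=1..n. bilin (\<tau> j) (\<tau> j) ^ ?m"
  let ?t = "\<lambda>j. tensor_power (\<tau> j) :: 'k ^ ('m \<Rightarrow> 'd)"
  have fin: "finite ?O"
    by (rule finite_subset[of _ "(\<lambda>(j, k). v (bilin (\<tau> j) (\<tau> k)) ^ (2 * ?m)) ` (?J \<times> ?J)"]) auto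
  have D_le: "v ?D \<le> ?M" using fin by simp
  have "diagonalizable_on Sym (\<lambda>x. \<Sum>j\<in>?J. bilin x (?t j) *s ?t j)"
    using assms(4) by (simp add: frame_operator_def[abs_def])
  then obtain B :: "('k ^ ('m \<Rightarrow> 'd)) set" and e where B: "finite B"
    and trace: "(\<Sum>b\<in>B. e b) = (\<Sum>j\<in>?J. bilin (?t j) (?t j))"
    and trace2: "(\<Sum>b\<in>B. (e b)\<^sup>2) = (\<Sum>j\<in>?J. \<Sum>k\<in>?J. (bilin (?t j) (?t k))\<^sup>2)"
    by (rule eigenvalue_sums) (rule tensor_power_in_Sym)
  have "(\<Sum>b\<in>B. (e b)\<^sup>2) = (\<Sum>j\<in>?J. \<Sum>k\<in>?J. bilin (\<tau> j) (\<tau> k) ^ (2 * ?m))"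
    by (simp add: trace2 bilin_tensor_power power_mult[symmetric] mult.commute)
  also have "\<dots> = ?D + (\<Sum>j\<in>?J. \<Sum>k\<in>?J - {j}. bilin (\<tau> j) (\<tau> k) ^ (2 * ?m))"
    unfolding sum.distrib[symmetric] by (intro sum.cong refl sum.remove) auto
  finally have split: "(\<Sum>b\<in>B. (e b)\<^sup>2)
      = ?D + (\<Sum>j\<in>?J. \<Sum>k\<in>?J - {j}. bilin (\<tau> j) (\<tau> k) ^ (2 * ?m))" .
  \<comment> \<open>Needed for \<open>abs_sum_le\<close>, since the off-diagonal sums are empty when
    \<open>n = 1\<close>.\<close>
  have M_nonneg: "0 \<le> ?M" using D_le abs_nonneg[of ?D] by linarith
  have offdiag: "v (bilin (\<tau> j) (\<tau> k) ^ (2 * ?m)) \<le> ?M"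
    if "j \<in> ?J" "k \<in> ?J - {j}" for j k
    unfolding abs_power using that fin by (intro Max_ge) auto
  have "(v ?T)\<^sup>2 = (v (\<Sum>b\<in>B. e b))\<^sup>2"
    by (simp add: trace bilin_tensor_power)
  also have "\<dots> \<le> v (\<Sum>b\<in>B. (e b)\<^sup>2)"
    by (rule abs_sum_power2_le[OF max B])
  also have "\<dots> \<le> max (v ?D) (v (\<Sum>j\<in>?J. \<Sum>k\<in>?J - {j}. bilin (\<tau> j) (\<tau> k) ^ (2 * ?m)))"
    unfolding split by (rule abs_add_le_max)
  also have "\<dots> \<le> ?M"
    by (intro max.boundedI D_le abs_sum_le M_nonneg offdiag)
  finally have main: "(v ?T)\<^sup>2 \<le> ?M" .
  \<comment> \<open>The truncated subtraction is harmless because the index type \<open>'d\<close>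
    is nonempty.\<close>
  have "?m \<le> CARD('d) + ?m - 1"
    using zero_less_card_finite[where 'a='d] by linarith
  then have C_pos: "?C \<ge> 1"
    by (simp add: Suc_le_eq)
  have C: "v (of_nat ?C) = 1"
    by (rule abs_of_nat_eq_1[OF max C_pos])
  \<comment> \<open>For normalized vectors both \<open>?D\<close> and \<open>?T\<close> equal
    \<open>of_nat n\<close>.\<close>
  have "(v (of_nat n))\<^sup>2 \<le> Max (insert (v (of_nat n)) ?O)" if "\<forall>j\<in>?J. bilin (\<tau> j) (\<tau> j) = 1"
    using main that by simp
  with main show ?thesis unfolding C by simp
qed

end
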